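(* Let $n\ge2$. Each of the following functions $\{0,1\}^n\times\{0,1\}^n\to\{0,1\}$ has garden-hose complexity at least $\frac{n}{\log(n)}$: the bitwise inner product $\mathrm{IP}(x,y)=\sum_i x_iy_i\pmod 2$, the equality function $\mathrm{EQ}(x,y)=1$ iff $x=y$, and the majority function $\mathrm{MAJ}(x,y)=1$ iff $\sum_i x_iy_i\ge\lfloor n/2\rfloor+1$.
   Context: Logarithms are base 2. Garden-hose game of size $s\in\mathbb{N}$: let $A=\{1^A,\dots,s^A\}$, $B=\{1^B,\dots,s^B\}$, $A_\circ=A\cup\{0\}$, and $E=\{\{i^A,i^B\}:1\le i\le s\}$ (the pipes). A game $G$ is given by functions $E_{A_\circ},E_B$ on $\{0,1\}^n$, where $E_{A_\circ}(x)$ is a set of edges (no self-loops) on $A_\circ$ and $E_B(y)$ is a set of edges (no self-loops) on $B$, such that the graphs $(A_\circ,E_{A_\circ}(x))$ and $(B,E_B(y))$ have maximum degree at most $1$. Put $G(x,y)=(A_\circ\cup B,\,E\cup E_{A_\circ}(x)\cup E_B(y))$. There is a unique maximal path $\pi(x,y)$ in $G(x,y)$ starting at $0$ (it consists of $0$ alone if $0$ has degree $0$). $G$ computes $f$ if for all $x,y$ the endpoint of $\pi(x,y)$ lies in $A_\circ$ when $f(x,y)=0$ and in $B$ when $f(x,y)=1$. The garden-hose complexity $GH(f)$ is the smallest size $s$ of a game computing $f$. *)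

theory Defs
  imports Complex_Main
begin

text \<open>
  Elements of \<open>{0,1}\<^sup>n\<close> are Boolean lists of length \<open>n\<close>; the \<open>i\<close>-th bit of the informal
  notation (\<open>1 \<le> i \<le> n\<close>) is \<open>x ! (i - 1)\<close>. The values 0 and 1 of a function \<open>f\<close> are
  \<open>False\<close> and \<open>True\<close>.
\<close>

type_synonym bits = "bool list"

definition bitstrings :: "nat \<Rightarrow> bits set" where
  "bitstrings n = {x. length x = n}"


text \<open>
  Graphs are given by a vertex set and a set of edges, an edge being a two-element set of
  vertices. A path is the nonempty sequence of its pairwise distinct vertices.
\<close>

definition edges_on :: "'v set \<Rightarrow> 'v set set" where
  "edges_on V = {e. e \<subseteq> V \<and> card e = 2}"

definition degree :: "'v set set \<Rightarrow> 'v \<Rightarrow> nat" where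
  "degree E v = card {e \<in> E. v \<in> e}"

definition is_path :: "'v set \<Rightarrow> 'v set set \<Rightarrow> 'v list \<Rightarrow> bool" where
  "is_path V E p \<longleftrightarrow> p \<noteq> [] \<and> set p \<subseteq> V \<and> distinct p \<and>
     (\<forall>i. Suc i < length p \<longrightarrow> {p ! i, p ! Suc i} \<in> E)"

definition is_maximal_path_from :: "'v set \<Rightarrow> 'v set set \<Rightarrow> 'v \<Rightarrow> 'v list \<Rightarrow> bool" where
  "is_maximal_path_from V E v p \<longleftrightarrow>
     is_path V E p \<and> hd p = v \<and> (\<forall>q. is_path V E (p @ q) \<longrightarrow> q = [])"


text \<open>\<open>Tap\<close> is the vertex 0, \<open>EndA i\<close> is \<open>i\<^sup>A\<close> and \<open>EndB i\<close> is \<open>i\<^sup>B\<close>.\<close>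

datatype vertex = Tap | EndA nat | EndB nat

definition A_side :: "nat \<Rightarrow> vertex set" where
  "A_side s = EndA ` {1..s}"

definition B_side :: "nat \<Rightarrow> vertex set" where
  "B_side s = EndB ` {1..s}"

definition A_tap :: "nat \<Rightarrow> vertex set" where
  "A_tap s = A_side s \<union> {Tap}"

definition pipes :: "nat \<Rightarrow> vertex set set" where
  "pipes s = {{EndA i, EndB i} | i. 1 \<le> i \<and> i \<le> s}"

text \<open>
  \<open>garden_hose_game n s EA EB\<close>: the functions \<open>EA\<close>, \<open>EB\<close> form a game of size \<open>s\<close> on
  \<open>{0,1}\<^sup>n\<close>. Their values on lists of other lengths are irrelevant.
\<close>

definition garden_hose_game ::
  "nat \<Rightarrow> nat \<Rightarrow> (bits \<Rightarrow> vertex set set) \<Rightarrow> (bits \<Rightarrow> vertex set set) \<Rightarrow> bool" where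
  "garden_hose_game n s EA EB \<longleftrightarrow>
     (\<forall>x \<in> bitstrings n. EA x \<subseteq> edges_on (A_tap s) \<and> (\<forall>v \<in> A_tap s. degree (EA x) v \<le> 1)) \<and>
     (\<forall>y \<in> bitstrings n. EB y \<subseteq> edges_on (B_side s) \<and> (\<forall>v \<in> B_side s. degree (EB y) v \<le> 1))"

definition game_vertices :: "nat \<Rightarrow> vertex set" where
  "game_vertices s = A_tap s \<union> B_side s"

definition game_edges ::
  "nat \<Rightarrow> (bits \<Rightarrow> vertex set set) \<Rightarrow> (bits \<Rightarrow> vertex set set) \<Rightarrow> bits \<Rightarrow> bits \<Rightarrow> vertex set set" where
  "game_edges s EA EB x y = pipes s \<union> EA x \<union> EB y"

definition game_path ::
  "nat \<Rightarrow> (bits \<Rightarrow> vertex set set) \<Rightarrow> (bits \<Rightarrow> vertex set set) \<Rightarrow> bits \<Rightarrow> bits \<Rightarrow> vertex list" where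
  "game_path s EA EB x y =
     (THE p. is_maximal_path_from (game_vertices s) (game_edges s EA EB x y) Tap p)"

definition game_computes ::
  "nat \<Rightarrow> nat \<Rightarrow> (bits \<Rightarrow> vertex set set) \<Rightarrow> (bits \<Rightarrow> vertex set set) \<Rightarrow>
   (bits \<Rightarrow> bits \<Rightarrow> bool) \<Rightarrow> bool" where
  "game_computes n s EA EB f \<longleftrightarrow>
     (\<forall>x \<in> bitstrings n. \<forall>y \<in> bitstrings n.
        (\<not> f x y \<longrightarrow> last (game_path s EA EB x y) \<in> A_tap s) \<and>
        (f x y \<longrightarrow> last (game_path s EA EB x y) \<in> B_side s))"

definition GH :: "nat \<Rightarrow> (bits \<Rightarrow> bits \<Rightarrow> bool) \<Rightarrow> nat" where
  "GH n f = (LEAST s. \<exists>EA EB. garden_hose_game n s EA EB \<and> game_computes n s EA EB f)"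


definition IP :: "nat \<Rightarrow> bits \<Rightarrow> bits \<Rightarrow> bool" where
  "IP n x y \<longleftrightarrow> (\<Sum>i<n. of_bool (x ! i) * of_bool (y ! i) :: nat) mod 2 = 1"

definition EQ :: "bits \<Rightarrow> bits \<Rightarrow> bool" where
  "EQ x y \<longleftrightarrow> x = y"

definition MAJ :: "nat \<Rightarrow> bits \<Rightarrow> bits \<Rightarrow> bool" where
  "MAJ n x y \<longleftrightarrow> (\<Sum>i<n. of_bool (x ! i) * of_bool (y ! i) :: nat) \<ge> n div 2 + 1"


text \<open>The path used in \<open>game_path\<close> exists and is unique.\<close>

lemma degree_le_1_unique:
  assumes "finite E" "degree E v \<le> 1" "e \<in> E" "e' \<in> E" "v \<in> e" "v \<in> e'"
  shows "e = e'"
proof -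
  have "finite {e \<in> E. v \<in> e}" using assms(1) by simp
  then show ?thesis
    using assms card_le_Suc0_iff_eq[of "{e \<in> E. v \<in> e}"] unfolding degree_def by auto
qed

lemma finite_sides [simp]: "finite (A_tap s)" "finite (B_side s)" "finite (game_vertices s)"
  by (auto simp: A_tap_def A_side_def B_side_def game_vertices_def)

lemma finite_edges_on: "finite V \<Longrightarrow> finite (edges_on V)"
  by (rule finite_subset[of _ "Pow V"]) (auto simp: edges_on_def)

lemma game_edge_unique:
  assumes G: "garden_hose_game n s EA EB" and x: "x \<in> bitstrings n" and y: "y \<in> bitstrings n"
    and e: "e \<in> EA x \<union> EB y" "e' \<in> EA x \<union> EB y" "v \<in> e" "v \<in> e'"
  shows "e = e'"
proof -
  have A: "EA x \<subseteq> edges_on (A_tap s)" "\<And>v. v \<in> A_tap s \<Longrightarrow> degree (EA x) v \<le> 1"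
    and B: "EB y \<subseteq> edges_on (B_side s)" "\<And>v. v \<in> B_side s \<Longrightarrow> degree (EB y) v \<le> 1"
    using G x y unfolding garden_hose_game_def by auto
  have fA: "finite (EA x)" and fB: "finite (EB y)"
    using A(1) B(1) by (meson finite_subset finite_edges_on finite_sides)+
  have disj: "A_tap s \<inter> B_side s = {}" by (auto simp: A_tap_def A_side_def B_side_def)
  have EA: "d \<subseteq> A_tap s" if "d \<in> EA x" for d using A(1) that by (auto simp: edges_on_def)
  have EB: "d \<subseteq> B_side s" if "d \<in> EB y" for d using B(1) that by (auto simp: edges_on_def)
  show ?thesis
  proof (cases "v \<in> A_tap s")
    case True
    then have "e \<in> EA x" "e' \<in> EA x" using e EB disj by blast+
    then show ?thesis using degree_le_1_unique[OF fA A(2)[OF True]] e by blast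
  next
    case False
    then have "e \<in> EB y" "e' \<in> EB y" using e EA by blast+
    moreover have "v \<in> B_side s" using calculation e EB by blast
    ultimately show ?thesis using degree_le_1_unique[OF fB B(2)] e by blast
  qed
qed

lemma pipe_unique: "e \<in> pipes s \<Longrightarrow> e' \<in> pipes s \<Longrightarrow> v \<in> e \<Longrightarrow> v \<in> e' \<Longrightarrow> e = e'"
  by (auto simp: pipes_def)

lemma is_path_successively:
  "is_path V E p \<longleftrightarrow> p \<noteq> [] \<and> set p \<subseteq> V \<and> distinct p \<and> successively (\<lambda>u v. {u, v} \<in> E) p"
  by (simp add: is_path_def successively_conv_nth)

lemma ex1_maximal_path:
  assumes G: "garden_hose_game n s EA EB" and x: "x \<in> bitstrings n" and y: "y \<in> bitstrings n"
  shows "\<exists>!p. is_maximal_path_from (game_vertices s) (game_edges s EA EB x y) Tap p"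
proof -
  define V where "V = game_vertices s"
  define E where "E = game_edges s EA EB x y"
  define P where "P p \<longleftrightarrow> is_path V E p \<and> hd p = Tap" for p
  have len: "length p \<le> card V" if "P p" for p
    using that card_mono[of V "set p"] distinct_card[of p]
    by (auto simp: P_def is_path_def V_def)
  have "P [Tap]" by (simp add: P_def is_path_def V_def game_vertices_def A_tap_def)
  then obtain p where p: "P p" "\<And>q. P q \<Longrightarrow> length q \<le> length p"
    using ex_has_greatest_nat[of P "[Tap]" length "Suc (card V)"] len
    by (auto simp: less_Suc_eq_le)
  have ex: "is_maximal_path_from V E Tap p"
    unfolding is_maximal_path_from_def
  proof (intro conjI allI impI)
    fix q assume "is_path V E (p @ q)"
    moreover have "p \<noteq> []" using p(1) by (simp add: P_def is_path_def)
    ultimately have "P (p @ q)" using p(1) by (simp add: P_def)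
    then show "q = []" using p(2) by fastforce
  qed (use p in \<open>auto simp: P_def\<close>)
  have E: "e \<in> E \<longleftrightarrow> e \<in> pipes s \<or> e \<in> EA x \<union> EB y" for e
    by (auto simp: E_def game_edges_def)
  note uniq = game_edge_unique[OF G x y]
  have two: "b = c \<or> a = b \<or> a = c" if "{w, a} \<in> E" "{w, b} \<in> E" "{w, c} \<in> E" for w a b c
  proof -
    have inj: "d = d'" if "{w, d} = {w, d'}" for d d' using that by (auto simp: doubleton_eq_iff)
    have 1: "d = d'" if "{w, d} \<in> pipes s" "{w, d'} \<in> pipes s" for d d'
      using pipe_unique[OF that, of w] inj by simp
    have 2: "d = d'" if "{w, d} \<in> EA x \<union> EB y" "{w, d'} \<in> EA x \<union> EB y" for d d'
      using uniq[OF that, of w] inj by simp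
    have "{w, d} \<in> pipes s \<or> {w, d} \<in> EA x \<union> EB y" if "{w, d} \<in> E" for d
      using that E by simp
    from this[OF that(1)] this[OF that(2)] this[OF that(3)] show ?thesis
      using 1[of a b] 1[of a c] 1[of b c] 2[of a b] 2[of a c] 2[of b c] by argo
  qed
  have one: "b = c" if "{Tap, b} \<in> E" "{Tap, c} \<in> E" for b c
  proof -
    have "{Tap, d} \<notin> pipes s" for d by (auto simp: pipes_def doubleton_eq_iff)
    then have "{Tap, b} \<in> EA x \<union> EB y" "{Tap, c} \<in> EA x \<union> EB y" using that unfolding E by blast+
    then have "{Tap, b} = {Tap, c}" using uniq[of "{Tap, b}" "{Tap, c}" Tap] by simp
    then show ?thesis by (auto simp: doubleton_eq_iff)
  qed
  have agree: "i < length p \<Longrightarrow> i < length q \<Longrightarrow> p ! i = q ! i" if pq: "P p" "P q" for p q i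
  proof (induction i rule: less_induct)
    case (less i)
    have d: "distinct p" "distinct q" using pq by (auto simp: P_def is_path_def)
    have h: "p ! 0 = Tap" "q ! 0 = Tap"
      using pq by (metis P_def is_path_def hd_conv_nth)+
    have edge: "Suc k = i \<Longrightarrow> {p ! k, p ! i} \<in> E" "Suc k = i \<Longrightarrow> {q ! k, q ! i} \<in> E" for k
      using pq less.prems by (auto simp: P_def is_path_def)
    consider "i = 0" | "i = 1" | k where "i = Suc (Suc k)"
      by (metis One_nat_def not0_implies_Suc)
    then show ?case
    proof cases
      case 1 then show ?thesis using h by simp
    next
      case 2 then show ?thesis using edge[of 0] h one by simp
    next
      case 3
      have eq: "p ! k = q ! k" "p ! Suc k = q ! Suc k" using less 3 by auto
      have e: "{p ! k, p ! Suc k} \<in> E" using pq less.prems 3 by (auto simp: P_def is_path_def)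
      have "p ! k \<noteq> p ! i" "q ! k \<noteq> q ! i"
        using d less.prems 3 by (auto simp: nth_eq_iff_index_eq)
      moreover have "{p ! Suc k, p ! k} \<in> E" using e by (simp add: insert_commute)
      ultimately show ?thesis
        using two[of "p ! Suc k" "p ! k" "p ! i" "q ! i"] edge[of "Suc k"] 3 eq by auto
    qed
  qed
  have le: "q = r" if qr: "is_maximal_path_from V E Tap q" "is_maximal_path_from V E Tap r"
    "length q \<le> length r" for q r
  proof -
    have PP: "P q" "P r" using qr by (auto simp: P_def is_maximal_path_from_def)
    have "q = take (length q) r"
      using agree[OF PP] qr(3) by (intro nth_equalityI) auto
    then have r: "q @ drop (length q) r = r" by (metis append_take_drop_id)
    then have "drop (length q) r = []"
      using qr(1) PP(2) by (metis P_def is_maximal_path_from_def)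
    then show ?thesis using r by simp
  qed
  show ?thesis
    using ex le unfolding V_def E_def by (metis nle_le)
qed

lemma game_path_eqI:
  assumes "garden_hose_game n s EA EB" "x \<in> bitstrings n" "y \<in> bitstrings n"
    and "is_maximal_path_from (game_vertices s) (game_edges s EA EB x y) Tap p"
  shows "game_path s EA EB x y = p"
  unfolding game_path_def using ex1_maximal_path[OF assms(1-3)] assms(4)
  by (rule the1_equality)


text \<open>Every function is computed by some game, so the minimum in \<open>GH\<close> is attained.\<close>

lemma finite_bitstrings: "finite (bitstrings n)"
  using finite_lists_length_eq[of "UNIV :: bool set" n] by (simp add: bitstrings_def)

lemma ex_game:
  "\<exists>s EA EB. garden_hose_game n s EA EB \<and> game_computes n s EA EB f"
proof -
  define N where "N = card (bitstrings n)"
  obtain c where c: "bij_betw c (bitstrings n) {1..N}"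
    using ex_bij_betw_nat_finite_1[OF finite_bitstrings] bij_betw_inv unfolding N_def by blast
  have cr: "1 \<le> c x" "c x \<le> N" if "x \<in> bitstrings n" for x
    using c that by (auto dest: bij_betwE)
  have ci: "c x = c x' \<longleftrightarrow> x = x'" if "x \<in> bitstrings n" "x' \<in> bitstrings n" for x x'
    using c that by (auto simp: bij_betw_def inj_on_def)
  define s where "s = 2 * N"
  define EA where "EA x = {{Tap, EndA (c x)}}" for x
  define EB where "EB y = {{EndB (c x), EndB (N + c x)} | x. x \<in> bitstrings n \<and> \<not> f x y}" for y
  have deg1: "degree E v \<le> 1" if "\<And>e e'. e \<in> E \<Longrightarrow> e' \<in> E \<Longrightarrow> v \<in> e \<Longrightarrow> v \<in> e' \<Longrightarrow> e = e'"
    for E :: "vertex set set" and v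
  proof (cases "finite {e \<in> E. v \<in> e}")
    case True
    then show ?thesis using that unfolding degree_def by (simp add: card_le_Suc0_iff_eq)
  qed (simp add: degree_def)
  have game: "garden_hose_game n s EA EB"
    unfolding garden_hose_game_def
  proof (intro conjI ballI)
    fix x assume "x \<in> bitstrings n"
    then show "EA x \<subseteq> edges_on (A_tap s)"
      using cr[of x] by (auto simp: EA_def edges_on_def A_tap_def A_side_def s_def)
    show "degree (EA x) v \<le> 1" for v by (rule deg1) (auto simp: EA_def)
  next
    fix y
    show "EB y \<subseteq> edges_on (B_side s)"
    proof
      fix e assume "e \<in> EB y"
      then obtain x where "x \<in> bitstrings n" "e = {EndB (c x), EndB (N + c x)}"
        by (auto simp: EB_def)
      then show "e \<in> edges_on (B_side s)"
        using cr[of x] by (auto simp: edges_on_def B_side_def s_def)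
    qed
    show "degree (EB y) v \<le> 1" for v
    proof (rule deg1)
      fix e e' assume "e \<in> EB y" "e' \<in> EB y" and v: "v \<in> e" "v \<in> e'"
      then obtain x x' where x: "x \<in> bitstrings n" "e = {EndB (c x), EndB (N + c x)}"
        "x' \<in> bitstrings n" "e' = {EndB (c x'), EndB (N + c x')}"
        by (auto simp: EB_def)
      then show "e = e'" using v cr[of x] cr[of x'] by auto
    qed
  qed
  have "game_computes n s EA EB f"
    unfolding game_computes_def
  proof (intro ballI)
    fix x y assume x: "x \<in> bitstrings n" and y: "y \<in> bitstrings n"
    let ?E = "game_edges s EA EB x y"
    have E: "{u, v} \<in> ?E \<longleftrightarrow>
        (\<exists>i. 1 \<le> i \<and> i \<le> s \<and> {u, v} = {EndA i, EndB i}) \<or> {u, v} = {Tap, EndA (c x)} \<or>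
        (\<exists>z. z \<in> bitstrings n \<and> \<not> f z y \<and> {u, v} = {EndB (c z), EndB (N + c z)})" for u v
      by (auto simp: game_edges_def pipes_def EA_def EB_def)
    have maxI: "is_maximal_path_from V F v p"
      if "is_path V F p" "hd p = v" "\<And>u. {last p, u} \<in> F \<Longrightarrow> u \<in> set p"
      for V F p and v :: vertex
      unfolding is_maximal_path_from_def
    proof (intro conjI allI impI, rule that(1), rule that(2), rule ccontr)
      fix q assume q: "is_path V F (p @ q)" "q \<noteq> []"
      have "p \<noteq> []" using that(1) by (simp add: is_path_def)
      then have "{(p @ q) ! (length p - 1), (p @ q) ! length p} \<in> F"
        using q unfolding is_path_def
        by (metis One_nat_def Suc_pred length_append length_greater_0_conv less_add_same_cancel1)
      then have "{last p, hd q} \<in> F"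
        using \<open>p \<noteq> []\<close> q(2) by (simp add: nth_append last_conv_nth hd_conv_nth)
      then have "hd q \<in> set p" by (rule that(3))
      then show False using q by (auto simp: is_path_def)
    qed
    let ?p = "[Tap, EndA (c x), EndB (c x)] @
      (if f x y then [] else [EndB (N + c x), EndA (N + c x)])"
    have "is_maximal_path_from (game_vertices s) ?E Tap ?p"
    proof (rule maxI)
      show "is_path (game_vertices s) ?E ?p"
        unfolding is_path_successively
      proof (intro conjI)
        show "set ?p \<subseteq> game_vertices s"
          using cr[OF x] by (auto simp: game_vertices_def A_tap_def A_side_def B_side_def s_def)
        show "distinct ?p" using cr[OF x] by auto
        have "{Tap, EndA (c x)} \<in> ?E" "{EndA (c x), EndB (c x)} \<in> ?E"
          "{EndB (N + c x), EndA (N + c x)} \<in> ?E"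
          using cr[OF x] by (auto simp: game_edges_def pipes_def EA_def s_def)
        moreover have "{EndB (c x), EndB (N + c x)} \<in> ?E" if "\<not> f x y"
          using that x by (auto simp: game_edges_def EB_def)
        ultimately show "successively (\<lambda>u v. {u, v} \<in> ?E) ?p" by simp
      qed simp
      show "hd ?p = Tap" by simp
      fix u assume "{last ?p, u} \<in> ?E"
      then consider i where "{last ?p, u} = {EndA i, EndB i}"
        | "{last ?p, u} = {Tap, EndA (c x)}"
        | z where "z \<in> bitstrings n" "\<not> f z y" "{last ?p, u} = {EndB (c z), EndB (N + c z)}"
        unfolding E by blast
      then show "u \<in> set ?p"
      proof cases
        case 1
        then show ?thesis by (auto simp: doubleton_eq_iff split: if_splits)
      next
        case 2
        then show ?thesis by (auto simp: doubleton_eq_iff split: if_splits)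
      next
        case 3
        have f: "f x y" using 3(3) by (auto simp: doubleton_eq_iff split: if_splits)
        then have "c x = c z \<or> c x = N + c z" using 3(3) by (auto simp: doubleton_eq_iff)
        then have "c x = c z" using cr(2)[OF x] cr(1)[OF 3(1)] by linarith
        then show ?thesis using ci[OF x 3(1)] f 3(2) by simp
      qed
    qed
    from game_path_eqI[OF game x y this]
    show "(\<not> f x y \<longrightarrow> last (game_path s EA EB x y) \<in> A_tap s) \<and>
          (f x y \<longrightarrow> last (game_path s EA EB x y) \<in> B_side s)"
      using cr[OF x] by (auto simp: A_tap_def A_side_def B_side_def s_def)
  qed
  with game show ?thesis by blast
qed

end

theory Submission
  imports Defs "HOL-Library.FuncSet"
begin

text \<open>
  The endpoint of the water path depends on \<open>y\<close> only through \<open>EB y\<close>, so strings \<open>y\<close> that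
  induce distinct functions \<open>f(\<cdot>, y)\<close> need distinct matchings on the \<open>s\<close> vertices of \<open>B\<close>, of
  which there are at most \<open>s\<^sup>s\<close>. If \<open>n\<^sup>s < 2\<^sup>n\<close> then \<open>s\<^sup>s \<le> 2\<^sup>n\<^sup>-\<^sup>2\<close>, so it suffices that more
  than \<open>2\<^sup>n\<^sup>-\<^sup>2\<close> strings are pairwise distinguished. The slack of \<open>4\<close> is only needed for
  majority, where all \<open>y\<close> of weight at most \<open>n/2\<close> induce the constant function 0.
\<close>

text \<open>The condition that \<open>garden_hose_game\<close> puts on \<open>EB y\<close>, for an
  arbitrary vertex set.\<close>

definition matchings :: "'v set \<Rightarrow> 'v set set set" where
  "matchings V = {M. M \<subseteq> edges_on V \<and> (\<forall>v\<in>V. degree M v \<le> 1)}"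

text \<open>A matching is determined by the self-map of \<open>V\<close> that swaps the ends of each
  edge and fixes the unmatched vertices, and \<open>V\<close> has only
  \<open>card V ^ card V\<close> self-maps.\<close>

lemma card_matchings_le:
  assumes "finite V"
  shows "card (matchings V) \<le> card V ^ card V"
proof -
  \<comment> \<open>The default \<open>v\<close> marks unmatched vertices. Edges of a matching have
    two elements, so a matched vertex is never fixed.\<close>
  define partner where
    "partner M v = (if \<exists>u. {v, u} \<in> M then SOME u. {v, u} \<in> M else v)" for M and v :: 'a
  have edge: "{v, partner M v} \<in> M" if "{v, u} \<in> M" for M v u
    using that someI[of "\<lambda>u. {v, u} \<in> M" u] by (auto simp: partner_def)
  have recover: "e \<in> M \<longleftrightarrow> (\<exists>v\<in>V. partner M v \<noteq> v \<and> e = {v, partner M v})"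
    if M: "M \<in> matchings V" for M e
  proof
    assume e: "e \<in> M"
    then obtain v u where vu: "e = {v, u}" "v \<noteq> u" "v \<in> V"
      using M by (auto simp: matchings_def edges_on_def card_2_iff)
    \<comment> \<open>Finiteness matters: \<open>degree\<close> is a cardinality, so in an infinite
      set of edges the bound 1 would not force uniqueness.\<close>
    have "finite M" "degree M v \<le> 1"
      using M vu assms finite_subset[OF _ finite_edges_on]
      by (auto simp: matchings_def)
    then have "{v, partner M v} = {v, u}"
      using degree_le_1_unique[of M v] edge[of v u M] e vu by blast
    then show "\<exists>v\<in>V. partner M v \<noteq> v \<and> e = {v, partner M v}"
      using vu by (metis doubleton_eq_iff)
  next
    assume "\<exists>v\<in>V. partner M v \<noteq> v \<and> e = {v, partner M v}"
    then show "e \<in> M" using edge by (metis partner_def)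
  qed
  have "card (matchings V) \<le> card (V \<rightarrow>\<^sub>E V)"
  proof (rule card_inj_on_le)
    show "inj_on (\<lambda>M. restrict (partner M) V) (matchings V)"
    proof (rule inj_onI)
      fix M M' assume M: "M \<in> matchings V" "M' \<in> matchings V"
        and "restrict (partner M) V = restrict (partner M') V"
      then have eq: "partner M v = partner M' v" if "v \<in> V" for v
        using that by (metis restrict_apply')
      have "e \<in> M \<longleftrightarrow> e \<in> M'" for e
        unfolding recover[OF M(1)] recover[OF M(2)] using eq by auto
      then show "M = M'" by blast
    qed
    show "(\<lambda>M. restrict (partner M) V) ` matchings V \<subseteq> V \<rightarrow>\<^sub>E V"
    proof clarify
      fix M assume M: "M \<in> matchings V"
      have "partner M v \<in> V" if "v \<in> V" for v
      proof (cases "partner M v = v")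
        case False
        then have "{v, partner M v} \<in> M" using recover[OF M] that by blast
        then show ?thesis using M by (auto simp: matchings_def edges_on_def)
      qed (use that in simp)
      then show "restrict (partner M) V \<in> V \<rightarrow>\<^sub>E V" by auto
    qed
    show "finite (V \<rightarrow>\<^sub>E V)" using assms by (intro finite_PiE) auto
  qed
  also have "\<dots> = card V ^ card V" using assms by (simp add: card_funcsetE)
  finally show ?thesis .
qed

lemma card_separated_le:
  assumes G: "garden_hose_game n s EA EB" and C: "game_computes n s EA EB f"
    and Y: "Y \<subseteq> bitstrings n"
    and sep: "\<And>y y'. y \<in> Y \<Longrightarrow> y' \<in> Y \<Longrightarrow> y \<noteq> y' \<Longrightarrow> \<exists>x\<in>bitstrings n. f x y \<noteq> f x y'"
  shows "card Y \<le> s ^ s"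
proof -
  \<comment> \<open>Disjoint sides turn the two implications of \<open>game_computes\<close> into an
    equivalence.\<close>
  have disj: "A_tap s \<inter> B_side s = {}" by (auto simp: A_tap_def A_side_def B_side_def)
  have val: "f x y \<longleftrightarrow> last (game_path s EA EB x y) \<in> B_side s"
    if "x \<in> bitstrings n" "y \<in> Y" for x y
    using C Y that disj unfolding game_computes_def by blast
  have "inj_on EB Y"
  proof (rule inj_onI, rule ccontr)
    fix y y' assume y: "y \<in> Y" "y' \<in> Y" "EB y = EB y'" "y \<noteq> y'"
    then have "game_path s EA EB x y = game_path s EA EB x y'" for x
      by (simp add: game_path_def game_edges_def)
    then show False using sep[of y y'] val y by metis
  qed
  moreover have "EB ` Y \<subseteq> matchings (B_side s)"
    using G Y by (auto simp: garden_hose_game_def matchings_def)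
  moreover have "finite (matchings (B_side s))"
    by (rule finite_subset[of _ "Pow (edges_on (B_side s))"])
      (auto simp: matchings_def finite_edges_on)
  ultimately have "card Y \<le> card (matchings (B_side s))" by (rule card_inj_on_le)
  also have "\<dots> \<le> card (B_side s) ^ card (B_side s)" by (simp add: card_matchings_le)
  also have "card (B_side s) = s" by (simp add: B_side_def card_image inj_on_def)
  finally show ?thesis .
qed

text \<open>For \<open>s \<ge> 2\<close> the hypothesis first yields \<open>2 * s < n\<close>. Then
  \<open>(2 * s) ^ s \<le> n ^ s < 2 ^ n\<close>, and cancelling the factor \<open>2 ^ s\<close>
  leaves \<open>s ^ s < 2 ^ (n - s)\<close>.\<close>

lemma self_power_le:
  fixes n s :: nat
  assumes n: "n \<ge> 2" and s: "n ^ s < 2 ^ n"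
  shows "s ^ s \<le> 2 ^ (n - 2)"
proof (cases "s \<ge> 2")
  case True
  \<comment> \<open>Otherwise \<open>n ^ s\<close> is at least 4 for \<open>n = 2\<close> and at
    least 9 for \<open>n = 3\<close>, hence not below \<open>2 ^ n\<close>.\<close>
  have n4: "n \<ge> 4"
  proof (rule ccontr)
    assume "\<not> n \<ge> 4"
    then have "n = 2 \<or> n = 3" using n by auto
    moreover have "n ^ 2 \<le> n ^ s" using True n by (intro power_increasing) auto
    ultimately show False using s by auto
  qed
  have "(2::nat) ^ (2 * s) = 4 ^ s" by (simp add: power_mult)
  also have "\<dots> \<le> n ^ s" using n4 by (intro power_mono) auto
  finally have "(2::nat) ^ (2 * s) < 2 ^ n" using s by (rule le_less_trans)
  then have sn: "2 * s < n" by (simp only: power_strict_increasing_iff one_less_numeral_iff semiring_norm)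
  have "2 ^ s * s ^ s = (2 * s) ^ s" by (simp add: power_mult_distrib)
  also have "\<dots> \<le> n ^ s" using sn by (intro power_mono) auto
  also have "\<dots> < 2 ^ n" by (rule s)
  also have "\<dots> = 2 ^ s * 2 ^ (n - s)" using sn by (simp flip: power_add)
  finally have "s ^ s < 2 ^ (n - s)" by simp
  also have "\<dots> \<le> 2 ^ (n - 2)" using True by (intro power_increasing) auto
  finally show ?thesis by simp
next
  case False
  \<comment> \<open>In both cases \<open>s ^ s = 1\<close>, with \<open>0 ^ 0 = 1\<close>.\<close>
  then have "s = 0 \<or> s = 1" by auto
  then show ?thesis by auto
qed

lemma GH_ge:
  assumes n: "n \<ge> 2" and Y: "Y \<subseteq> bitstrings n" "2 ^ (n - 2) < card Y"
    and sep: "\<And>y y'. y \<in> Y \<Longrightarrow> y' \<in> Y \<Longrightarrow> y \<noteq> y' \<Longrightarrow> \<exists>x\<in>bitstrings n. f x y \<noteq> f x y'"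
  shows "real n / log 2 (real n) \<le> real (GH n f)"
proof (rule ccontr)
  define s where "s = GH n f"
  assume "\<not> ?thesis"
  moreover have "log 2 (real n) > 0" using n by simp
  ultimately have "real s * log 2 (real n) < real n" by (simp add: field_simps s_def)
  then have "2 powr (log 2 (real n) * real s) < 2 powr real n" by (simp add: mult.commute)
  then have "real (n ^ s) < real (2 ^ n)"
    using n by (simp add: powr_powr[symmetric] powr_realpow)
  then have "s ^ s \<le> 2 ^ (n - 2)" using self_power_le[OF n] of_nat_less_iff by blast
  \<comment> \<open>By \<open>ex_game\<close> the minimum in \<open>GH\<close> is attained, so a
    game of size exactly \<open>s\<close> is at hand.\<close>
  moreover obtain EA EB where "garden_hose_game n s EA EB" "game_computes n s EA EB f"
    using LeastI_ex[OF ex_game[of n f]] unfolding s_def GH_def by blast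
  then have "card Y \<le> s ^ s" using card_separated_le Y(1) sep by blast
  ultimately show False using Y(2) by simp
qed

lemma card_bitstrings: "card (bitstrings n) = 2 ^ n"
  using card_lists_length_eq[of "UNIV :: bool set" n] by (simp add: bitstrings_def)

lemma overlap_eq_card:
  "(\<Sum>i<n. of_bool (x ! i) * of_bool (y ! i) :: nat) = card {i. i < n \<and> x ! i \<and> y ! i}"
proof -
  have "(\<Sum>i<n. of_bool (x ! i) * of_bool (y ! i) :: nat) = (\<Sum>i<n. of_bool (x ! i \<and> y ! i))"
    by (simp add: of_bool_conj)
  also have "\<dots> = card ({..<n} \<inter> {i. x ! i \<and> y ! i})"
    by (simp add: sum_of_bool_eq)
  also have "{..<n} \<inter> {i. x ! i \<and> y ! i} = {i. i < n \<and> x ! i \<and> y ! i}" by auto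
  finally show ?thesis .
qed

lemma overlap_indicator:
  assumes "T \<subseteq> {..<n}"
  shows "(\<Sum>i<n. of_bool (map (\<lambda>i. i \<in> T) [0..<n] ! i) * of_bool (y ! i) :: nat)
    = card {i \<in> T. y ! i}"
  unfolding overlap_eq_card using assms by (intro arg_cong[where f = card]) auto

lemma indicator_in_bitstrings: "map P [0..<n] \<in> bitstrings n"
  by (simp add: bitstrings_def)

text \<open>The unit vector at a position where \<open>y\<close> and \<open>y'\<close> differ reads
  off that bit.\<close>

lemma IP_separates:
  assumes "y \<in> bitstrings n" "y' \<in> bitstrings n" "y \<noteq> y'"
  shows "\<exists>x\<in>bitstrings n. IP n x y \<noteq> IP n x y'"
proof -
  obtain i where i: "i < n" "y ! i \<noteq> y' ! i"
    using assms by (auto simp: bitstrings_def list_eq_iff_nth_eq)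
  have "IP n (map (\<lambda>j. j \<in> {i}) [0..<n]) z \<longleftrightarrow> z ! i" for z
  proof -
    have "{j \<in> {i}. z ! j} = (if z ! i then {i} else {})" by auto
    then show ?thesis using i(1) unfolding IP_def by (subst overlap_indicator) auto
  qed
  then show ?thesis using i(2) indicator_in_bitstrings by blast
qed

text \<open>Let \<open>x\<close> mark \<open>i\<close> and \<open>n div 2\<close> further ones of
  \<open>y\<close>. The overlap with \<open>y\<close> just meets the threshold, while
  \<open>y'\<close>, lacking \<open>i\<close>, falls short of it.\<close>

lemma MAJ_separates:
  assumes y: "y \<in> bitstrings n" and y': "y' \<in> bitstrings n"
    and w: "n div 2 < card {i. i < n \<and> y ! i}" and i: "i < n" "y ! i" "\<not> y' ! i"
  shows "\<exists>x\<in>bitstrings n. MAJ n x y \<noteq> MAJ n x y'"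
proof -
  have "n div 2 \<le> card ({i. i < n \<and> y ! i} - {i})" using w i by simp
  then obtain T where T: "T \<subseteq> {i. i < n \<and> y ! i} - {i}" "card T = n div 2"
    using obtain_subset_with_card_n by metis
  have fin: "finite T" using T(1) by (rule finite_subset) simp
  let ?x = "map (\<lambda>j. j \<in> insert i T) [0..<n]"
  have sub: "insert i T \<subseteq> {..<n}" using T i by auto
  have "{j \<in> insert i T. y ! j} = insert i T" using T i by auto
  moreover have "i \<notin> T" using T by auto
  ultimately have "MAJ n ?x y"
    unfolding MAJ_def overlap_indicator[OF sub] using T(2) fin by simp
  moreover have "card {j \<in> insert i T. y' ! j} \<le> card T" using i fin by (intro card_mono) auto
  then have "\<not> MAJ n ?x y'"
    unfolding MAJ_def overlap_indicator[OF sub] using T(2) by simp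
  ultimately show ?thesis using indicator_in_bitstrings by metis
qed

text \<open>Each \<open>z\<close> of length \<open>n - 2\<close>, either as it is or complemented,
  extends to a heavy string: \<open>z\<close> and its complement have \<open>n - 2\<close> ones
  between them, so they cannot both be too light.\<close>

lemma card_heavy_ge:
  assumes "n \<ge> 2"
  shows "2 ^ (n - 2) \<le> card {y \<in> bitstrings n. n div 2 < card {i. i < n \<and> y ! i}}"
proof -
  \<comment> \<open>The second bit records whether \<open>z\<close> was complemented, which makes
    \<open>g\<close> injective. In the uncomplemented case both leading bits count, so
    \<open>z\<close> may lack two of the \<open>n div 2 + 1\<close> ones.\<close>
  define g where "g z = (if n div 2 \<le> Suc (length (filter id z)) then True # True # z
    else True # False # map Not z)" for z
  have "inj_on g (bitstrings (n - 2))"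
    by (rule inj_onI) (auto simp: g_def inj_map_eq_map inj_def split: if_splits)
  moreover have "g ` bitstrings (n - 2)
    \<subseteq> {y \<in> bitstrings n. n div 2 < card {i. i < n \<and> y ! i}}"
  proof clarify
    fix z assume z: "z \<in> bitstrings (n - 2)"
    have gn: "length (g z) = n" using z assms by (auto simp: g_def bitstrings_def)
    have "length (filter id z) + length (filter id (map Not z)) = n - 2"
      using z sum_length_filter_compl[of id z] by (simp add: bitstrings_def filter_map comp_def)
    then have "n div 2 < length (filter id (g z))"
      using assms by (auto simp: g_def)
    then show "g z \<in> bitstrings n \<and> n div 2 < card {i. i < n \<and> g z ! i}"
      using gn by (simp add: length_filter_conv_card bitstrings_def)
  qed
  ultimately have "card (bitstrings (n - 2))
    \<le> card {y \<in> bitstrings n. n div 2 < card {i. i < n \<and> y ! i}}"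
    by (rule card_inj_on_le) (simp add: finite_bitstrings)
  then show ?thesis by (simp add: card_bitstrings)
qed

theorem corollary4p11:
  fixes n :: nat
  assumes "n \<ge> 2"
  shows "real (GH n (IP n)) \<ge> real n / log 2 (real n) \<and>
         real (GH n EQ) \<ge> real n / log 2 (real n) \<and>
         real (GH n (MAJ n)) \<ge> real n / log 2 (real n)"
proof (intro conjI)
  have all: "2 ^ (n - 2) < card (bitstrings n)"
    using assms by (simp add: card_bitstrings)
  show "real n / log 2 (real n) \<le> real (GH n (IP n))"
    by (rule GH_ge[OF assms subset_refl all IP_separates])
  \<comment> \<open>Here \<open>x = y\<close> itself separates \<open>y\<close> from every other
    string.\<close>
  show "real n / log 2 (real n) \<le> real (GH n EQ)"
    by (rule GH_ge[OF assms subset_refl all]) (auto simp: EQ_def)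
  define H where "H = {y \<in> bitstrings n. n div 2 < card {i. i < n \<and> y ! i}}"
  \<comment> \<open>The zero string is the extra member that makes the bound of
    \<open>card_heavy_ge\<close> strict; for \<open>n = 2\<close> that bound is an equality.\<close>
  define z where "z = replicate n False"
  have z: "z \<in> bitstrings n" "z \<notin> H" "\<And>i. i < n \<Longrightarrow> \<not> z ! i"
    by (auto simp: z_def H_def bitstrings_def cong: conj_cong)
  have H: "H \<subseteq> bitstrings n" by (auto simp: H_def)
  have "finite H" using H finite_bitstrings by (rule finite_subset)
  then have card: "2 ^ (n - 2) < card (insert z H)"
    using z(2) card_heavy_ge[OF assms] by (simp add: H_def)
  show "real n / log 2 (real n) \<le> real (GH n (MAJ n))"
  proof (rule GH_ge[OF assms _ card])
    show "insert z H \<subseteq> bitstrings n" using z(1) H by simp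
    fix y y' assume y: "y \<in> insert z H" "y' \<in> insert z H" "y \<noteq> y'"
    then have b: "y \<in> bitstrings n" "y' \<in> bitstrings n" using z(1) H by auto
    obtain i where i: "i < n" "y ! i \<noteq> y' ! i"
      using b y(3) by (auto simp: bitstrings_def list_eq_iff_nth_eq)
    \<comment> \<open>Whichever of the two strings has a 1 at \<open>i\<close> is not
      \<open>z\<close>, hence is heavy and can take the first role in the asymmetric
      \<open>MAJ_separates\<close>.\<close>
    have heavy: "n div 2 < card {i. i < n \<and> u ! i}" if "u \<in> insert z H" "u ! i" for u
      using that z(3)[OF i(1)] by (auto simp: H_def)
    show "\<exists>x\<in>bitstrings n. MAJ n x y \<noteq> MAJ n x y'"
    proof (cases "y ! i")
      case True
      then show ?thesis using MAJ_separates[OF b heavy[OF y(1)]] i by blast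
    next
      case False
      then have "\<exists>x\<in>bitstrings n. MAJ n x y' \<noteq> MAJ n x y"
        using MAJ_separates[OF b(2,1) heavy[OF y(2)]] i by blast
      then show ?thesis by metis
    qed
  qed
qed

end
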